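(* Let $k$ and $m$ be positive integers and let $\ell_1,\ell_2,\ldots,\ell_k$ be positive integers. Let $U$ be a linear space over a field $\mathbb{F}$, and let $U_{ij}$ ($1\le i\le m$, $1\le j\le k$) be subspaces of $U$. Suppose that: (i) for every $1\le j\le k$ and $1\le i\le m$, $\dim U_{ij}\le \ell_j$; (ii) for every fixed $i$ with $1\le i\le m$, $\dim\left(\sum_{j=1}^k U_{ij}\right)=\sum_{j=1}^k \dim U_{ij}$; (iii) for all $1\le i<i'\le m$, there exist $1\le j<j'\le k$ such that $U_{ij}\cap U_{i'j'}\neq\{0\}$. Then \[m\le \frac{\left(\sum_{r=1}^k \ell_r\right)!}{\prod_{r=1}^k \ell_r!}.\]
   Context: The subspaces $U_{ij}$ are regarded as an $m\times k$ matrix of subspaces, with $i$ indexing rows and $j$ indexing columns. The sum in (ii) is the sum of subspaces of $U$. *)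

theory Defs
  imports Complex_Main "HOL-Library.Set_Algebras"
begin

(* The ambient space need not be finite-dimensional, and the constant dim of the
   library assigns 0 to infinite-dimensional spaces. A bound on the dimension
   therefore has to include finite-dimensionality explicitly. *)
definition (in vector_space) dim_at_most :: "'b set \<Rightarrow> nat \<Rightarrow> bool" where
  "dim_at_most S n \<longleftrightarrow> (\<exists>B. finite B \<and> span B = S) \<and> dim S \<le> n"

(* The addition of sets from Set_Algebras makes (\<Sum>j=1..k. U i j) the usual sum of
   subspaces, i.e. the set of all sums of u j with u j \<in> U i j. *)

end

theory Submission
  imports Defs "Jordan_Normal_Form.Determinant"
begin

text \<open>
  The bound is a product of binomial coefficients, and each factor is the number of terms in a
  Laplace expansion. Write \<open>a j\<close> for the sum of the first \<open>j\<close> of the numbers \<open>l\<close>; with indices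
  starting at 0, the multinomial coefficient is the product over \<open>j < k\<close> of
  \<open>a (j + 1) choose a j\<close>.

  Suppose for simplicity that every space in column \<open>j\<close> has dimension exactly \<open>l j\<close> and that the
  field is infinite. For each \<open>j\<close> fix a generic linear map from \<open>U\<close> to a space of dimension
  \<open>a (j + 1)\<close> that is injective on the sum of the first \<open>j + 1\<close> subspaces of every row. Let
  \<open>M j i i'\<close> be the determinant whose rows are the images of bases of the first \<open>j\<close> subspaces of
  row \<open>i\<close> of the given matrix of subspaces, followed by the image of a basis of subspace \<open>j\<close> of
  row \<open>i'\<close>. If subspace \<open>j\<close> of row \<open>i\<close> meets subspace \<open>j'\<close> of row \<open>i'\<close> nontrivially for some
  \<open>j < j'\<close>, then the rows of the determinant \<open>M j' i i'\<close> are dependent. Hence the entrywise product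
  of the \<open>k\<close> matrices \<open>M j\<close> vanishes at all positions \<open>i < i'\<close>, while its diagonal entries are
  nonzero by the directness of the sums. It is an \<open>m\<close> by \<open>m\<close> triangular matrix of full rank.
  On the other hand, Laplace expansion (\<open>det_split_rows\<close>) writes \<open>M j i i'\<close> as a sum of
  \<open>a (j + 1) choose a j\<close> terms, each a function of \<open>i\<close> times a function of \<open>i'\<close>; so the entrywise
  product has rank at most the product of these numbers. Comparing the ranks
  (\<open>card_ge_of_triangular_factorization\<close>) gives the bound.

  Two reductions remain. Subspaces of too small dimension are padded with new coordinates that are
  independent of everything else (\<open>padded_coordinates\<close>). For a finite field, generic maps need not
  exist, so the maps take values in the polynomial ring over the field
  (\<open>skew_flag_bound_domain\<close>). This ring is an infinite domain, and that is
  enough for generic maps to exist and for the determinants to detect dependencies.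
\<close>

section \<open>The rank of a triangular matrix\<close>

text \<open>
  A triangular matrix with nonzero diagonal cannot factor through fewer than \<open>m\<close> dimensions: padding
  the two factors with zeros to square matrices would make the determinant of the product zero.
\<close>
lemma card_ge_of_triangular_factorization:
  fixes P Q :: "'i \<Rightarrow> nat \<Rightarrow> 'a::idom"
  assumes fin: "finite I"
    and zero: "\<And>i i'. i < i' \<Longrightarrow> i' < m \<Longrightarrow> (\<Sum>\<sigma>\<in>I. P \<sigma> i * Q \<sigma> i') = 0"
    and diag: "\<And>i. i < m \<Longrightarrow> (\<Sum>\<sigma>\<in>I. P \<sigma> i * Q \<sigma> i) \<noteq> 0"
  shows "m \<le> card I"
proof (rule ccontr)
  assume "\<not> m \<le> card I"
  then have less: "card I < m" by simp
  obtain h where h: "bij_betw h {0..<card I} I"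
    using ex_bij_betw_nat_finite[OF fin] by blast
  define A where "A = mat m m (\<lambda>(i,t). if t < card I then P (h t) i else 0)"
  define B where "B = mat m m (\<lambda>(t,i). if t < card I then Q (h t) i else 0)"
  have [simp]: "A \<in> carrier_mat m m" "B \<in> carrier_mat m m"
    by (simp_all add: A_def B_def)
  have entry: "(A * B) $$ (i,i') = (\<Sum>\<sigma>\<in>I. P \<sigma> i * Q \<sigma> i')" if "i < m" "i' < m" for i i'
  proof -
    have "(A * B) $$ (i,i') = (\<Sum>t = 0..<m. if t < card I then P (h t) i * Q (h t) i' else 0)"
      using that by (auto simp: A_def B_def scalar_prod_def intro!: sum.cong)
    also have "\<dots> = (\<Sum>t = 0..<card I. P (h t) i * Q (h t) i')"
      using less by (intro sum.mono_neutral_cong_right) auto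
    also have "\<dots> = (\<Sum>\<sigma>\<in>I. P \<sigma> i * Q \<sigma> i')"
      by (rule sum.reindex_bij_betw[OF h])
    finally show ?thesis .
  qed
  have "det A = (\<Sum>i<m. A $$ (i, card I) * cofactor A i (card I))"
    by (rule laplace_expansion_column) (use less in auto)
  also have "\<dots> = 0"
    using less by (intro sum.neutral) (auto simp: A_def)
  finally have "det (A * B) = 0" by (simp add: det_mult[of A m B])
  moreover have "det (A * B) = prod_list (diag_mat (A * B))"
    by (rule det_lower_triangular[where n = m])
       (auto simp: entry zero simp del: index_mult_mat(1) intro!: mult_carrier_mat[of A m m])
  moreover have "prod_list (diag_mat (A * B)) \<noteq> 0"
  proof -
    have "dim_row (A * B) = m" by (simp add: A_def)
    then show ?thesis
      by (auto simp: prod_list_zero_iff diag_mat_def entry diag simp del: index_mult_mat)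
  qed
  ultimately show False by simp
qed

section \<open>Laplace expansion along a block of rows\<close>
lemma ex_permutes_image:
  fixes n a :: nat
  assumes "S \<subseteq> {0..<n}" "card S = a"
  shows "\<exists>p. p permutes {0..<n} \<and> p ` {0..<a} = S"
proof -
  have fS: "finite S" using assms finite_subset by blast
  have "a \<le> n" using card_mono[OF _ assms(1)] assms(2) by simp
  obtain f where f: "bij_betw f {0..<a} S"
    using ex_bij_betw_nat_finite[OF fS] assms by auto
  have "card {a..<n} = card ({0..<n} - S)"
    using assms fS by (simp add: card_Diff_subset)
  then obtain g where g: "bij_betw g {a..<n} ({0..<n} - S)"
    using finite_same_card_bij by blast
  define p where "p = (\<lambda>x. if x \<in> {0..<a} then f x else if x \<in> {a..<n} then g x else x)"
  have pf: "bij_betw p {0..<a} S"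
    using f by (rule bij_betw_cong[THEN iffD1, rotated]) (auto simp: p_def)
  have pg: "bij_betw p {a..<n} ({0..<n} - S)"
    using g by (rule bij_betw_cong[THEN iffD1, rotated]) (auto simp: p_def)
  have "bij_betw p ({0..<a} \<union> {a..<n}) (S \<union> ({0..<n} - S))"
    by (rule bij_betw_combine[OF pf pg]) auto
  moreover have "{0..<a} \<union> {a..<n} = {0..<n}" "S \<union> ({0..<n} - S) = {0..<n}"
    using \<open>a \<le> n\<close> assms by auto
  ultimately have "bij_betw p {0..<n} {0..<n}" by simp
  then have "p permutes {0..<n}"
    by (rule bij_imp_permutes) (use \<open>a \<le> n\<close> in \<open>auto simp: p_def\<close>)
  with pf show ?thesis by (auto simp: bij_betw_def)
qed

text \<open>
  The stabiliser of an initial segment in the symmetric group is the product of the symmetric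
  groups of the segment and of its complement.
\<close>
lemma permutes_preserving_initial_segment:
  fixes n a :: nat
  assumes "a \<le> n"
  shows "bij_betw (\<lambda>(q1, q2). q1 \<circ> q2)
           ({q. q permutes {0..<a}} \<times> {q. q permutes {a..<n}})
           {q. q permutes {0..<n} \<and> q ` {0..<a} = {0..<a}}"
proof (rule bij_betwI[where g = "\<lambda>q. (restrict_id q {0..<a}, restrict_id q {a..<n})"], goal_cases)
  case 1
  show ?case
  proof (rule funcsetI)
    fix x assume "x \<in> {q. q permutes {0..<a}} \<times> {q. q permutes {a..<n}}"
    then obtain q1 q2 where x: "x = (q1, q2)"
      and q: "q1 permutes {0..<a}" "q2 permutes {a..<n}" by (cases x) simp
    have "q1 \<circ> q2 permutes {0..<n}"
      by (intro permutes_compose permutes_subset[OF q(1)] permutes_subset[OF q(2)])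
         (use assms in auto)
    moreover have "(q1 \<circ> q2) ` {0..<a} = q1 ` {0..<a}"
      by (intro image_cong) (simp_all add: permutes_not_in[OF q(2)])
    ultimately show "(case x of (q1, q2) \<Rightarrow> q1 \<circ> q2) \<in>
        {q. q permutes {0..<n} \<and> q ` {0..<a} = {0..<a}}"
      by (simp only: x permutes_image[OF q(1)] prod.case mem_Collect_eq simp_thms)
  qed
next
  case 2
  show ?case
  proof (rule funcsetI)
    fix q assume "q \<in> {q. q permutes {0..<n} \<and> q ` {0..<a} = {0..<a}}"
    then have q: "q permutes {0..<n}" "q ` {0..<a} = {0..<a}" by simp_all
    have inj: "inj q" using q(1) permutes_inj by blast
    have eq: "{a..<n} = {0..<n} - {0..<a}" using assms by auto
    have "q ` {a..<n} = {a..<n}"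
      unfolding eq image_set_diff[OF inj] q(2) permutes_image[OF q(1)] ..
    then have "restrict_id q {a..<n} permutes {a..<n}"
      by (intro permutes_restrict_id) (simp add: bij_betw_def inj_on_subset[OF inj])
    moreover have "restrict_id q {0..<a} permutes {0..<a}"
      by (intro permutes_restrict_id) (simp add: bij_betw_def inj_on_subset[OF inj] q(2))
    ultimately show "(restrict_id q {0..<a}, restrict_id q {a..<n})
        \<in> {q. q permutes {0..<a}} \<times> {q. q permutes {a..<n}}" by simp
  qed
next
  case (3 x)
  obtain q1 q2 where x: "x = (q1, q2)" by (cases x)
  with 3 have q: "q1 permutes {0..<a}" "q2 permutes {a..<n}" by auto
  have "restrict_id (q1 \<circ> q2) {0..<a} t = q1 t" for t
    by (cases "t < a") (simp_all add: permutes_not_in[OF q(1)] permutes_not_in[OF q(2)])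
  moreover have "restrict_id (q1 \<circ> q2) {a..<n} t = q2 t" for t
  proof (cases "t \<in> {a..<n}")
    case True
    then have "q2 t \<in> {a..<n}" using permutes_in_image[OF q(2)] by simp
    then have "q1 (q2 t) = q2 t" by (simp add: permutes_not_in[OF q(1)])
    then show ?thesis using True by (simp add: restrict_id_def)
  next
    case False
    then show ?thesis by (simp add: permutes_not_in[OF q(2)])
  qed
  ultimately show ?case by (auto simp: x)
next
  case (4 q)
  then have q: "q permutes {0..<n}" "q ` {0..<a} = {0..<a}" by auto
  have inj: "inj q" using q(1) permutes_inj by blast
  have "q t \<in> {a..<n}" if "t \<in> {a..<n}" for t
  proof -
    have "q t \<in> {0..<n}" using that permutes_in_image[OF q(1), of t] by simp
    moreover have "q t \<notin> q ` {0..<a}" using that by (simp add: inj_image_mem_iff[OF inj])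
    ultimately show ?thesis by (simp add: q(2))
  qed
  moreover have "q t < a" if "t < a" for t
  proof -
    have "q t \<in> q ` {0..<a}" using that by simp
    then show ?thesis by (simp add: q(2))
  qed
  ultimately have "(restrict_id q {0..<a} \<circ> restrict_id q {a..<n}) t = q t" for t
    using permutes_not_in[OF q(1), of t] by (simp add: restrict_id_def) (meson leD)
  then show ?case by (simp add: fun_eq_iff)
qed

text \<open>
  Only the number of terms and the separation of the two blocks matter later, so the
  minors and the signs stay hidden in \<open>C\<close> and \<open>D\<close>. The proof sorts the permutations of the Leibniz
  formula by the set \<open>S\<close> of columns that the first \<open>a\<close> rows use: those with a given \<open>S\<close> form one
  coset of the stabiliser of the initial segment, on which sign and product are multiplicative.
\<close>
lemma det_split_rows:
  fixes a n :: nat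
  assumes an: "a \<le> n"
  obtains C D :: "nat set \<Rightarrow> (nat \<Rightarrow> nat \<Rightarrow> 'a::comm_ring_1) \<Rightarrow> 'a" where
    "\<And>A B. det (mat n n (\<lambda>(s,r). if s < a then A s r else B s r)) =
       (\<Sum>S | S \<subseteq> {0..<n} \<and> card S = a. C S A * D S B)"
proof -
  let ?Ss = "{S. S \<subseteq> {0..<n} \<and> card S = a}"
  let ?Q = "{q. q permutes {0..<n} \<and> q ` {0..<a} = {0..<a}}"
  have "\<forall>S\<in>?Ss. \<exists>p. p permutes {0..<n} \<and> p ` {0..<a} = S"
    by (intro ballI ex_permutes_image) simp_all
  from bchoice[OF this] obtain p
    where p: "\<And>S. S \<in> ?Ss \<Longrightarrow> p S permutes {0..<n} \<and> p S ` {0..<a} = S" by meson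
  \<comment> \<open>\<open>p S\<close> is a coset representative; its sign is charged to the first block.\<close>
  define C where "C = (\<lambda>S A. \<Sum>q | q permutes {0..<a}.
    (signof (p S) * signof q * (\<Prod>s = 0..<a. A s (p S (q s))) :: 'a))"
  define D where "D = (\<lambda>S B. \<Sum>q | q permutes {a..<n}.
    (signof q * (\<Prod>s = a..<n. B s (p S (q s))) :: 'a))"
  show thesis
  proof (rule that[of C D])
    fix A B :: "nat \<Rightarrow> nat \<Rightarrow> 'a"
    let ?M = "\<lambda>s r. if s < a then A s r else B s r"
    let ?t = "\<lambda>p. signof p * (\<Prod>s = 0..<n. ?M s (p s))"
    have "det (mat n n (\<lambda>(s,r). ?M s r)) = (\<Sum>p | p permutes {0..<n}. ?t p)"
      by (subst det_def'[of _ n])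
         (auto intro!: sum.cong prod.cong arg_cong2[of _ _ _ _ "(*)"] simp: permutes_in_image)
    also have "\<dots> = (\<Sum>S\<in>?Ss. \<Sum>p \<in> {p \<in> {p. p permutes {0..<n}}. p ` {0..<a} = S}. ?t p)"
    proof (rule sum.group[symmetric])
      show "finite {p. p permutes {0..<n}}" by (simp add: finite_permutations)
      show "finite ?Ss" by (rule finite_subset[of _ "Pow {0..<n}"]) auto
      show "(\<lambda>p. p ` {0..<a}) ` {p. p permutes {0..<n}} \<subseteq> ?Ss"
      proof (rule image_subsetI)
        fix q assume "q \<in> {p. p permutes {0..<n}}"
        then have q: "q permutes {0..<n}" by simp
        have "q ` {0..<a} \<subseteq> q ` {0..<n}" using an by (intro image_mono) auto
        moreover have "card (q ` {0..<a}) = a"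
          by (subst card_image) (simp_all add: inj_on_subset[OF permutes_inj[OF q]])
        ultimately show "q ` {0..<a} \<in> ?Ss" by (simp add: permutes_image[OF q])
      qed
    qed
    also have "\<dots> = (\<Sum>S\<in>?Ss. C S A * D S B)"
    proof (rule sum.cong[OF refl])
      fix S assume S: "S \<in> ?Ss"
      have pS: "p S permutes {0..<n}" "p S ` {0..<a} = S" using p[OF S] by auto
      have bij: "bij_betw (\<lambda>q. p S \<circ> q) ?Q {p \<in> {p. p permutes {0..<n}}. p ` {0..<a} = S}"
      proof (rule bij_betwI[where g = "\<lambda>q. inv_into UNIV (p S) \<circ> q"])
        show "(\<lambda>q. p S \<circ> q) \<in> ?Q \<rightarrow> {p \<in> {p. p permutes {0..<n}}. p ` {0..<a} = S}"
        proof (rule funcsetI)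
          fix q assume "q \<in> ?Q"
          then have q: "q permutes {0..<n}" "q ` {0..<a} = {0..<a}" by simp_all
          have "(p S \<circ> q) ` {0..<a} = S" unfolding image_comp[symmetric] q(2) pS(2) ..
          with permutes_compose[OF q(1) pS(1)]
          show "p S \<circ> q \<in> {p \<in> {p. p permutes {0..<n}}. p ` {0..<a} = S}" by simp
        qed
        have inv_pS: "inv_into UNIV (p S) ` S = {0..<a}"
          using image_inv_f_f[OF permutes_inj[OF pS(1)], of "{0..<a}"] pS(2) by simp
        show "(\<lambda>q. inv_into UNIV (p S) \<circ> q) \<in> {p \<in> {p. p permutes {0..<n}}. p ` {0..<a} = S} \<rightarrow> ?Q"
        proof (rule funcsetI)
          fix q assume "q \<in> {p \<in> {p. p permutes {0..<n}}. p ` {0..<a} = S}"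
          then have q: "q permutes {0..<n}" "q ` {0..<a} = S" by simp_all
          have "(inv_into UNIV (p S) \<circ> q) ` {0..<a} = {0..<a}"
            unfolding image_comp[symmetric] q(2) inv_pS ..
          with permutes_compose[OF q(1) permutes_inv[OF pS(1)]]
          show "inv_into UNIV (p S) \<circ> q \<in> ?Q" by simp
        qed
        show "inv_into UNIV (p S) \<circ> (p S \<circ> q) = q" for q
          by (simp add: o_assoc permutes_inv_o[OF pS(1)])
        show "p S \<circ> (inv_into UNIV (p S) \<circ> q) = q" for q
          by (simp add: o_assoc permutes_inv_o[OF pS(1)])
      qed
      have "(\<Sum>p \<in> {p \<in> {p. p permutes {0..<n}}. p ` {0..<a} = S}. ?t p) = (\<Sum>q\<in>?Q. ?t (p S \<circ> q))"
        by (rule sum.reindex_bij_betw[OF bij, symmetric])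
      also have "\<dots> = (\<Sum>(q1,q2)\<in>{q. q permutes {0..<a}} \<times> {q. q permutes {a..<n}}. ?t (p S \<circ> (q1 \<circ> q2)))"
        by (subst sum.reindex_bij_betw[OF permutes_preserving_initial_segment[OF an], symmetric])
           (rule sum.cong[OF refl], simp only: case_prod_beta)
      also have "\<dots> = (\<Sum>(q1,q2)\<in>{q. q permutes {0..<a}} \<times> {q. q permutes {a..<n}}.
          (signof (p S) * signof q1 * (\<Prod>s = 0..<a. A s (p S (q1 s)))) *
          (signof q2 * (\<Prod>s = a..<n. B s (p S (q2 s)))))"
      proof (rule sum.cong[OF refl])
        fix x assume "x \<in> {q. q permutes {0..<a}} \<times> {q. q permutes {a..<n}}"
        then obtain q1 q2 where x: "x = (q1, q2)"
          and q: "q1 permutes {0..<a}" "q2 permutes {a..<n}" by (cases x) simp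
        have perm: "permutation (p S)" "permutation q1" "permutation q2"
          
          by (rule permutes_imp_permutation[OF _ pS(1)] permutes_imp_permutation[OF _ q(1)]
              permutes_imp_permutation[OF _ q(2)]; simp)+
        have "signof (p S \<circ> (q1 \<circ> q2)) = (signof (p S) * signof q1 * signof q2 :: 'a)"
          using perm by (simp add: sign_compose permutation_compose mult.assoc)
        moreover have "(\<Prod>s = 0..<n. ?M s ((p S \<circ> (q1 \<circ> q2)) s)) =
          (\<Prod>s = 0..<a. A s (p S (q1 s))) * (\<Prod>s = a..<n. B s (p S (q2 s)))"
        proof -
          have "(\<Prod>s = 0..<n. ?M s ((p S \<circ> (q1 \<circ> q2)) s)) =
            (\<Prod>s = 0..<a. ?M s ((p S \<circ> (q1 \<circ> q2)) s)) * (\<Prod>s = a..<n. ?M s ((p S \<circ> (q1 \<circ> q2)) s))"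
            by (rule prod.atLeastLessThan_concat[symmetric]) (use an in simp_all)
          also have "(\<Prod>s = 0..<a. ?M s ((p S \<circ> (q1 \<circ> q2)) s)) = (\<Prod>s = 0..<a. A s (p S (q1 s)))"
            by (intro prod.cong) (simp_all add: permutes_not_in[OF q(2)])
          also have "(\<Prod>s = a..<n. ?M s ((p S \<circ> (q1 \<circ> q2)) s)) = (\<Prod>s = a..<n. B s (p S (q2 s)))"
          proof (rule prod.cong[OF refl])
            fix s assume s: "s \<in> {a..<n}"
            then have "q2 s \<in> {a..<n}" using permutes_in_image[OF q(2)] by simp
            then have "q1 (q2 s) = q2 s" by (simp add: permutes_not_in[OF q(1)])
            then show "?M s ((p S \<circ> (q1 \<circ> q2)) s) = B s (p S (q2 s))" using s by simp
          qed
          finally show ?thesis .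
        qed
        ultimately show "(case x of (q1, q2) \<Rightarrow> ?t (p S \<circ> (q1 \<circ> q2))) =
          (case x of (q1, q2) \<Rightarrow>
            (signof (p S) * signof q1 * (\<Prod>s = 0..<a. A s (p S (q1 s)))) *
            (signof q2 * (\<Prod>s = a..<n. B s (p S (q2 s)))))"
          by (simp only: x prod.case mult_ac)
      qed
      also have "\<dots> = C S A * D S B"
        unfolding C_def D_def sum_product by (simp add: sum.cartesian_product)
      finally show "(\<Sum>p \<in> {p \<in> {p. p permutes {0..<n}}. p ` {0..<a} = S}. ?t p) = C S A * D S B" .
    qed
    finally show "det (mat n n (\<lambda>(s,r). ?M s r)) = (\<Sum>S\<in>?Ss. C S A * D S B)" .
  qed
qed

section \<open>Generic linear maps\<close>

text \<open>
  Such a functional exists on the moment curve: its coefficients are distinct powers of one element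
  \<open>z\<close>, and each of the vectors \<open>g i\<close> excludes only the finitely many roots of a nonzero polynomial.
\<close>
lemma infinite_idom_common_functional:
  fixes g :: "'i \<Rightarrow> 'c \<Rightarrow> 'a::idom"
  assumes inf: "infinite (UNIV :: 'a set)" and "finite I" "finite C"
    and nz: "\<And>i. i \<in> I \<Longrightarrow> \<exists>c\<in>C. g i c \<noteq> 0"
  shows "\<exists>f. \<forall>i\<in>I. (\<Sum>c\<in>C. f c * g i c) \<noteq> 0"
proof -
  obtain e :: "'c \<Rightarrow> nat" where e: "inj_on e C"
    using finite_imp_inj_to_nat_seg[OF \<open>finite C\<close>] by blast
  define p where "p = (\<lambda>i. \<Sum>c\<in>C. monom (g i c) (e c))"
  have "p i \<noteq> 0" if i: "i \<in> I" for i
  proof -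
    obtain c where c: "c \<in> C" "g i c \<noteq> 0" using nz[OF i] by blast
    have "coeff (p i) (e c) = (\<Sum>c'\<in>C. if c' = c then g i c' else 0)"
      unfolding p_def coeff_sum
      by (rule sum.cong) (use c e in \<open>auto simp: inj_on_eq_iff\<close>)
    also have "\<dots> = g i c" using c \<open>finite C\<close> by simp
    finally show ?thesis using c by auto
  qed
  then have "finite (\<Union>i\<in>I. {z. poly (p i) z = 0})"
    using \<open>finite I\<close> by (simp add: poly_roots_finite)
  then obtain z where z: "z \<notin> (\<Union>i\<in>I. {z. poly (p i) z = 0})"
    using ex_new_if_finite[OF inf] by blast
  show ?thesis
  proof (rule exI[of _ "\<lambda>c. z ^ e c"], rule ballI)
    fix i assume "i \<in> I"
    then have "poly (p i) z \<noteq> 0" using z by blast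
    then show "(\<Sum>c\<in>C. z ^ e c * g i c) \<noteq> 0"
      by (simp add: p_def poly_sum poly_monom mult.commute)
  qed
qed

text \<open>
  Vectors are given by their coordinates, indexed by \<open>C\<close>; the \<open>n\<close> functionals \<open>\<tau>\<close> are the components
  of a linear map to \<open>n\<close>-dimensional space, and the rows of the matrix are the images of the vectors
  \<open>Y\<close>.
\<close>
definition eval_mat :: "'c set \<Rightarrow> nat \<Rightarrow> (nat \<Rightarrow> 'c \<Rightarrow> 'a::comm_ring_1) \<Rightarrow> (nat \<Rightarrow> 'c \<Rightarrow> 'a) \<Rightarrow> 'a mat"
  where "eval_mat C n Y \<tau> = mat n n (\<lambda>(s,r). \<Sum>c\<in>C. \<tau> r c * Y s c)"

lemma eval_mat_carrier [simp]: "eval_mat C n Y \<tau> \<in> carrier_mat n n"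
  by (simp add: eval_mat_def)

lemma det_eval_mat_linear_in_functional:
  fixes Y \<tau> :: "nat \<Rightarrow> 'c \<Rightarrow> 'a::comm_ring_1"
  assumes r: "r < n"
  shows "\<exists>g. \<forall>f. det (eval_mat C n Y (\<tau>(r := f))) = (\<Sum>c\<in>C. f c * g c)"
proof (intro exI allI)
  fix f :: "'c \<Rightarrow> 'a"
  let ?M = "\<lambda>f. eval_mat C n Y (\<tau>(r := f))"
  let ?h = "\<lambda>s. cofactor (eval_mat C n Y \<tau>) s r"
  have cof: "cofactor (?M f) s r = ?h s" if "s < n" for s
  proof -
    have "mat_delete (?M f) s r = mat_delete (eval_mat C n Y \<tau>) s r"
      by (rule eq_matI) (use r that in \<open>auto simp: mat_delete_def eval_mat_def\<close>)
    then show ?thesis by (simp add: cofactor_def)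
  qed
  have "det (?M f) = (\<Sum>s<n. ?M f $$ (s, r) * cofactor (?M f) s r)"
    by (rule laplace_expansion_column) (use r in simp_all)
  also have "\<dots> = (\<Sum>s<n. (\<Sum>c\<in>C. f c * Y s c) * ?h s)"
    by (rule sum.cong) (use r cof in \<open>simp_all add: eval_mat_def\<close>)
  also have "\<dots> = (\<Sum>c\<in>C. f c * (\<Sum>s<n. Y s c * ?h s))"
    unfolding sum_distrib_right sum_distrib_left by (subst sum.swap) (simp only: mult.assoc)
  finally show "det (?M f) = (\<Sum>c\<in>C. f c * (\<Sum>s<n. Y s c * ?h s))" .
qed

text \<open>
  The maps \<open>T i\<close> that work for the single families are made equal one functional at a time:
  the determinant is linear in the functional number \<open>r\<close>, and is not the zero form because the present
  \<open>T i r\<close> gives a nonzero value, so a common choice for all \<open>i\<close> keeps every determinant nonzero.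
\<close>
lemma generic_projection:
  fixes Y :: "'i \<Rightarrow> nat \<Rightarrow> 'c \<Rightarrow> 'a::idom"
  assumes inf: "infinite (UNIV :: 'a set)" and "finite I" "finite C"
    and ex: "\<And>i. i \<in> I \<Longrightarrow> \<exists>\<tau>. det (eval_mat C n (Y i) \<tau>) \<noteq> 0"
  shows "\<exists>\<tau>. \<forall>i\<in>I. det (eval_mat C n (Y i) \<tau>) \<noteq> 0"
proof -
  have "\<exists>T. (\<forall>i\<in>I. det (eval_mat C n (Y i) (T i)) \<noteq> 0) \<and> (\<forall>i\<in>I. \<forall>i'\<in>I. \<forall>q<r. T i q = T i' q)"
    if "r \<le> n" for r
    using that
  proof (induction r)
    case 0
    then show ?case using bchoice[of I "\<lambda>i \<tau>. det (eval_mat C n (Y i) \<tau>) \<noteq> 0"] ex by simp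
  next
    case (Suc r)
    from Suc.IH[OF Suc_leD[OF Suc.prems]]
    obtain T where T: "\<forall>i\<in>I. det (eval_mat C n (Y i) (T i)) \<noteq> 0"
      and agree: "\<forall>i\<in>I. \<forall>i'\<in>I. \<forall>q<r. T i q = T i' q" by (elim exE conjE)
    have "\<forall>i. \<exists>g. \<forall>f. det (eval_mat C n (Y i) ((T i)(r := f))) = (\<Sum>c\<in>C. f c * g c)"
      using det_eval_mat_linear_in_functional[OF Suc_le_lessD[OF Suc.prems]] by (rule allI)
    from choice[OF this] obtain g
      where g: "\<forall>i f. det (eval_mat C n (Y i) ((T i)(r := f))) = (\<Sum>c\<in>C. f c * g i c)"
      by (rule exE)
    have "\<exists>c\<in>C. g i c \<noteq> 0" if i: "i \<in> I" for i
    proof (rule ccontr)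
      assume "\<not> (\<exists>c\<in>C. g i c \<noteq> 0)"
      then have "(\<Sum>c\<in>C. T i r c * g i c) = 0" by (intro sum.neutral) simp
      with g[rule_format, of i "T i r"] T i show False by simp
    qed
    from infinite_idom_common_functional[OF inf \<open>finite I\<close> \<open>finite C\<close> this]
    obtain f where f: "\<forall>i\<in>I. (\<Sum>c\<in>C. f c * g i c) \<noteq> 0" by (rule exE)
    show ?case
    proof (intro exI[of _ "\<lambda>i. (T i)(r := f)"] conjI ballI allI impI)
      fix i i' q assume i: "i \<in> I" "i' \<in> I" and q: "q < Suc r"
      show "((T i)(r := f)) q = ((T i')(r := f)) q"
        using agree[rule_format, OF i, of q] q by (cases "q = r") (simp_all only: fun_upd_apply less_Suc_eq simp_thms if_True if_False)
    qed (simp only: g[rule_format] f[rule_format] not_False_eq_True)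
  qed
  from this[OF order_refl]
  obtain T where T: "\<forall>i\<in>I. det (eval_mat C n (Y i) (T i)) \<noteq> 0"
    and agree: "\<forall>i\<in>I. \<forall>i'\<in>I. \<forall>q<n. T i q = T i' q" by (elim exE conjE)
  show ?thesis
  proof (cases "I = {}")
    case True
    then show ?thesis by simp
  next
    case False
    then obtain i0 where i0: "i0 \<in> I" by blast
    show ?thesis
    proof (rule exI[of _ "T i0"], rule ballI)
      fix i assume i: "i \<in> I"
      have "eval_mat C n (Y i) (T i0) = eval_mat C n (Y i) (T i)"
        by (rule eq_matI) (simp_all add: eval_mat_def agree[rule_format, OF i0 i])
      then show "det (eval_mat C n (Y i) (T i0)) \<noteq> 0" using T i by simp
    qed
  qed
qed

lemma det_eval_mat_zero_if_rows_dependent: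
  fixes Y \<tau> :: "nat \<Rightarrow> 'c \<Rightarrow> 'a::idom"
  assumes nz: "s0 < n" "\<gamma> s0 \<noteq> 0"
    and dep: "\<And>c. c \<in> C \<Longrightarrow> (\<Sum>s = 0..<n. \<gamma> s * Y s c) = 0"
  shows "det (eval_mat C n Y \<tau>) = 0"
proof -
  let ?M = "eval_mat C n Y \<tau>"
  have "(transpose_mat ?M) *\<^sub>v vec n \<gamma> = 0\<^sub>v n"
  proof (rule eq_vecI)
    fix r assume "r < dim_vec (0\<^sub>v n :: 'a vec)"
    then have r: "r < n" by simp
    have "(transpose_mat ?M *\<^sub>v vec n \<gamma>) $ r = (\<Sum>s = 0..<n. (\<Sum>c\<in>C. \<tau> r c * Y s c) * \<gamma> s)"
      using r by (auto simp: eval_mat_def scalar_prod_def intro!: sum.cong)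
    also have "\<dots> = (\<Sum>c\<in>C. \<tau> r c * (\<Sum>s = 0..<n. \<gamma> s * Y s c))"
      unfolding sum_distrib_right sum_distrib_left by (subst sum.swap) (simp only: mult_ac)
    also have "\<dots> = 0" by (simp add: dep)
    finally show "(transpose_mat ?M *\<^sub>v vec n \<gamma>) $ r = 0\<^sub>v n $ r" using r by simp
  qed (simp add: eval_mat_def)
  moreover have "vec n \<gamma> \<noteq> 0\<^sub>v n"
    using nz by (metis index_vec index_zero_vec(1))
  ultimately have "det (transpose_mat ?M) = 0"
    by (intro det_0_iff_vec_prod_zero[of _ n, THEN iffD2] exI[of _ "vec n \<gamma>"]) simp_all
  then show ?thesis by (simp add: det_transpose[of _ n])
qed

section \<open>The bound for families of vectors\<close>
lemma finite_subsets_of_card: "finite {S. S \<subseteq> {0..<n::nat} \<and> card S = a}"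
  by (rule finite_subset[of _ "Pow {0..<n}"]) auto

text \<open>
  The vectors \<open>X i s\<close> with \<open>a j \<le> s < a (Suc j)\<close> play the role of a basis of the subspace in row \<open>i\<close>
  and column \<open>j\<close>. Independence appears as the existence of a dual system of functionals, because
  this form survives extension of scalars to a ring that is not a field.
\<close>
lemma skew_flag_bound_infinite_domain:
  fixes X :: "nat \<Rightarrow> nat \<Rightarrow> 'c \<Rightarrow> 'a::idom" and a :: "nat \<Rightarrow> nat" and k m :: nat
  assumes inf: "infinite (UNIV :: 'a set)" and "mono a" and finC: "finite C"
    and dual: "\<And>i. i < m \<Longrightarrow> \<exists>\<tau>. \<forall>s<a k. \<forall>r<a k. (\<Sum>c\<in>C. \<tau> r c * X i s c) = (if s = r then 1 else 0)"
    and meet: "\<And>i i'. i < i' \<Longrightarrow> i' < m \<Longrightarrow> \<exists>j j' \<alpha> \<beta>. j < j' \<and> j' < k \<and>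
      (\<exists>s\<in>{a j..<a (Suc j)}. \<alpha> s \<noteq> 0) \<and>
      (\<forall>c\<in>C. (\<Sum>s\<in>{a j..<a (Suc j)}. \<alpha> s * X i s c) = (\<Sum>s\<in>{a j'..<a (Suc j')}. \<beta> s * X i' s c))"
  shows "m \<le> (\<Prod>j<k. a (Suc j) choose a j)"
proof -
  have a_mono: "a j \<le> a j'" if "j \<le> j'" for j j'
    using \<open>mono a\<close> that by (rule monoD)
  have "\<exists>\<tau>. \<forall>i\<in>{..<m}. det (eval_mat C (a (Suc j)) (X i) \<tau>) \<noteq> 0" if j: "j < k" for j
  proof -
    have "\<exists>\<tau>. det (eval_mat C (a (Suc j)) (X i) \<tau>) \<noteq> 0" if "i \<in> {..<m}" for i
    proof -
      have le: "a (Suc j) \<le> a k" using j by (intro a_mono) simp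
      have "i < m" using that by simp
      from dual[OF this] obtain \<tau>
        where \<tau>: "\<forall>s<a k. \<forall>r<a k. (\<Sum>c\<in>C. \<tau> r c * X i s c) = (if s = r then 1 else 0)"
        by (rule exE)
      have "eval_mat C (a (Suc j)) (X i) \<tau> = 1\<^sub>m (a (Suc j))"
        by (rule eq_matI) (use \<tau> le in \<open>simp_all add: eval_mat_def\<close>)
      then show ?thesis by (intro exI[of _ \<tau>]) simp
    qed
    from generic_projection[OF inf finite_lessThan finC this] show ?thesis .
  qed
  then have "\<forall>j\<in>{..<k}. \<exists>\<tau>. \<forall>i\<in>{..<m}. det (eval_mat C (a (Suc j)) (X i) \<tau>) \<noteq> 0" by simp
  from bchoice[OF this] obtain \<tau> where \<tau>:
    "\<forall>j\<in>{..<k}. \<forall>i\<in>{..<m}. det (eval_mat C (a (Suc j)) (X i) (\<tau> j)) \<noteq> 0" by (rule exE)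
  \<comment> \<open>\<open>E j i\<close> lists the images of the vectors of row \<open>i\<close> under the generic map of stage \<open>j\<close>.\<close>
  define E where "E = (\<lambda>j i s r. \<Sum>c\<in>C. \<tau> j r c * X i s c)"
  define M where "M = (\<lambda>j i i'. det (eval_mat C (a (Suc j)) (\<lambda>s. if s < a j then X i s else X i' s) (\<tau> j)))"
  let ?Ss = "\<lambda>j. {S. S \<subseteq> {0..<a (Suc j)} \<and> card S = a j}"
  have "\<exists>C D. \<forall>i i'. M j i i' = (\<Sum>S\<in>?Ss j. C S (E j i) * D S (E j i'))" for j
  proof -
    obtain C' D :: "nat set \<Rightarrow> (nat \<Rightarrow> nat \<Rightarrow> 'a) \<Rightarrow> 'a" where CD:
      "\<And>A B. det (mat (a (Suc j)) (a (Suc j)) (\<lambda>(s,r). if s < a j then A s r else B s r)) =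
        (\<Sum>S\<in>?Ss j. C' S A * D S B)"
      using det_split_rows[OF a_mono[of j "Suc j"]] by auto
    have "M j i i' = (\<Sum>S\<in>?Ss j. C' S (E j i) * D S (E j i'))" for i i'
      unfolding CD[symmetric] M_def eval_mat_def E_def
      by (rule arg_cong[of _ _ det], rule eq_matI) simp_all
    then show ?thesis by (intro exI allI)
  qed
  then have "\<forall>j. \<exists>C. \<exists>D. \<forall>i i'. M j i i' = (\<Sum>S\<in>?Ss j. C S (E j i) * D S (E j i'))" by (intro allI)
  from choice[OF this] obtain P
    where "\<forall>j. \<exists>D. \<forall>i i'. M j i i' = (\<Sum>S\<in>?Ss j. P j S (E j i) * D S (E j i'))" by (rule exE)
  from choice[OF this] obtain Q
    where PQ: "\<forall>j. \<forall>i i'. M j i i' = (\<Sum>S\<in>?Ss j. P j S (E j i) * Q j S (E j i'))" by (rule exE)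
  \<comment> \<open>Expanding the product over \<open>j\<close> of the \<open>k\<close> sums chooses one set of columns for every \<open>j\<close>.\<close>
  let ?I = "PiE {..<k} ?Ss"
  let ?P = "\<lambda>\<sigma> i. \<Prod>j<k. P j (\<sigma> j) (E j i)"
  let ?Q = "\<lambda>\<sigma> i. \<Prod>j<k. Q j (\<sigma> j) (E j i)"
  have prod_M: "(\<Prod>j<k. M j i i') = (\<Sum>\<sigma>\<in>?I. ?P \<sigma> i * ?Q \<sigma> i')" for i i'
  proof -
    have "(\<Prod>j<k. M j i i') = (\<Prod>j<k. \<Sum>S\<in>?Ss j. P j S (E j i) * Q j S (E j i'))"
      using PQ by (intro prod.cong refl) blast
    also have "\<dots> = (\<Sum>\<sigma>\<in>?I. \<Prod>j<k. P j (\<sigma> j) (E j i) * Q j (\<sigma> j) (E j i'))"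
      by (rule prod_sum_PiE) (simp_all add: finite_subsets_of_card)
    finally show ?thesis by (simp only: prod.distrib)
  qed
  have zero: "(\<Prod>j<k. M j i i') = 0" if ii: "i < i'" "i' < m" for i i'
  proof -
    obtain j j' \<alpha> \<beta> where jj: "j < j'" "j' < k" and nz: "\<exists>s\<in>{a j..<a (Suc j)}. \<alpha> s \<noteq> 0"
      and eq: "\<forall>c\<in>C. (\<Sum>s\<in>{a j..<a (Suc j)}. \<alpha> s * X i s c) = (\<Sum>s\<in>{a j'..<a (Suc j')}. \<beta> s * X i' s c)"
      using meet[OF ii] by (elim exE conjE)
    obtain s0 where s0: "s0 \<in> {a j..<a (Suc j)}" "\<alpha> s0 \<noteq> 0" using nz by (rule bexE)
    have le: "a (Suc j) \<le> a j'" "a j' \<le> a (Suc j')" using jj by (auto intro: a_mono)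
    let ?Z = "\<lambda>s. if s < a j' then X i s else X i' s"
    \<comment> \<open>The common vector of the two blocks is a linear dependency among the rows of \<open>M j' i i'\<close>.\<close>
    define \<gamma> where "\<gamma> = (\<lambda>s. if s \<in> {a j..<a (Suc j)} then \<alpha> s
        else if s \<in> {a j'..<a (Suc j')} then - \<beta> s else 0)"
    have "(\<Sum>s = 0..<a (Suc j'). \<gamma> s * ?Z s c) = 0" if c: "c \<in> C" for c
    proof -
      have "(\<Sum>s = 0..<a (Suc j'). \<gamma> s * ?Z s c) =
        (\<Sum>s\<in>{a j..<a (Suc j)} \<union> {a j'..<a (Suc j')}. \<gamma> s * ?Z s c)"
        by (rule sum.mono_neutral_right) (use le in \<open>auto simp: \<gamma>_def\<close>)
      also have "\<dots> = (\<Sum>s\<in>{a j..<a (Suc j)}. \<gamma> s * ?Z s c) + (\<Sum>s\<in>{a j'..<a (Suc j')}. \<gamma> s * ?Z s c)"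
        by (rule sum.union_disjoint) (use le in auto)
      also have "(\<Sum>s\<in>{a j..<a (Suc j)}. \<gamma> s * ?Z s c) = (\<Sum>s\<in>{a j..<a (Suc j)}. \<alpha> s * X i s c)"
        by (rule sum.cong) (use le in \<open>auto simp: \<gamma>_def\<close>)
      also have "(\<Sum>s\<in>{a j'..<a (Suc j')}. \<gamma> s * ?Z s c) = (\<Sum>s\<in>{a j'..<a (Suc j')}. - (\<beta> s * X i' s c))"
        by (rule sum.cong) (use le in \<open>auto simp: \<gamma>_def\<close>)
      also have "\<dots> = - (\<Sum>s\<in>{a j'..<a (Suc j')}. \<beta> s * X i' s c)" by (rule sum_negf)
      finally show ?thesis using eq c by simp
    qed
    moreover have "s0 < a (Suc j')" "\<gamma> s0 \<noteq> 0" using s0 le by (auto simp: \<gamma>_def)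
    ultimately have "M j' i i' = 0"
      unfolding M_def by (intro det_eval_mat_zero_if_rows_dependent)
    then show ?thesis using jj by (auto intro!: bexI[of _ j'] simp: prod_zero_iff)
  qed
  have diag: "(\<Prod>j<k. M j i i) \<noteq> 0" if "i < m" for i
    using \<tau> that by (simp add: M_def)
  have "m \<le> card ?I"
    using zero diag unfolding prod_M
    by (intro card_ge_of_triangular_factorization[of ?I m ?P ?Q])
       (simp_all add: finite_PiE finite_subsets_of_card)
  also have "card ?I = (\<Prod>j<k. a (Suc j) choose a j)"
    by (simp add: card_PiE n_subsets)
  finally show ?thesis .
qed

text \<open>
  Constant polynomials embed the coefficients into an infinite domain, and both hypotheses are
  identities that the embedding preserves.
\<close>
lemma skew_flag_bound_domain:
  fixes X :: "nat \<Rightarrow> nat \<Rightarrow> 'c \<Rightarrow> 'a::idom" and a :: "nat \<Rightarrow> nat" and k m :: nat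
  assumes "mono a" and finC: "finite C"
    and dual: "\<And>i. i < m \<Longrightarrow> \<exists>\<tau>. \<forall>s<a k. \<forall>r<a k. (\<Sum>c\<in>C. \<tau> r c * X i s c) = (if s = r then 1 else 0)"
    and meet: "\<And>i i'. i < i' \<Longrightarrow> i' < m \<Longrightarrow> \<exists>j j' \<alpha> \<beta>. j < j' \<and> j' < k \<and>
      (\<exists>s\<in>{a j..<a (Suc j)}. \<alpha> s \<noteq> 0) \<and>
      (\<forall>c\<in>C. (\<Sum>s\<in>{a j..<a (Suc j)}. \<alpha> s * X i s c) = (\<Sum>s\<in>{a j'..<a (Suc j')}. \<beta> s * X i' s c))"
  shows "m \<le> (\<Prod>j<k. a (Suc j) choose a j)"
proof -
  have const_sum: "(\<Sum>t\<in>T. [:f t:] * [:g t:]) = [:\<Sum>t\<in>T. f t * g t:]"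
    for T :: "'t set" and f g :: "'t \<Rightarrow> 'a"
    by (induction T rule: infinite_finite_induct) simp_all
  have inf: "infinite (UNIV :: 'a poly set)"
  proof -
    have "inj (\<lambda>n. monom (1::'a) n)"
      by (rule injI) (metis degree_monom_eq one_neq_zero)
    then show ?thesis using finite_imageD infinite_UNIV_nat by (metis finite_subset subset_UNIV)
  qed
  show ?thesis
  proof (rule skew_flag_bound_infinite_domain[OF inf \<open>mono a\<close> finC, of m k "\<lambda>i s c. [:X i s c:]"])
    fix i assume "i < m"
    from dual[OF this] obtain \<tau>
      where "\<forall>s<a k. \<forall>r<a k. (\<Sum>c\<in>C. \<tau> r c * X i s c) = (if s = r then 1 else 0)" by (rule exE)
    then show "\<exists>\<tau>. \<forall>s<a k. \<forall>r<a k. (\<Sum>c\<in>C. \<tau> r c * [:X i s c:]) = (if s = r then 1 else 0)"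
      by (intro exI[of _ "\<lambda>r c. [:\<tau> r c:]"]) (simp only: const_sum, simp add: one_pCons)
  next
    fix i i' assume ii: "i < i'" "i' < m"
    obtain j j' \<alpha> \<beta> where "j < j'" "j' < k" "\<exists>s\<in>{a j..<a (Suc j)}. \<alpha> s \<noteq> 0"
      "\<forall>c\<in>C. (\<Sum>s\<in>{a j..<a (Suc j)}. \<alpha> s * X i s c) = (\<Sum>s\<in>{a j'..<a (Suc j')}. \<beta> s * X i' s c)"
      using meet[OF ii] by (elim exE conjE)
    then show "\<exists>j j' \<alpha> \<beta>. j < j' \<and> j' < k \<and> (\<exists>s\<in>{a j..<a (Suc j)}. \<alpha> s \<noteq> 0) \<and>
      (\<forall>c\<in>C. (\<Sum>s\<in>{a j..<a (Suc j)}. \<alpha> s * [:X i s c:]) = (\<Sum>s\<in>{a j'..<a (Suc j')}. \<beta> s * [:X i' s c:]))"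
      by (intro exI[of _ j] exI[of _ j'] exI[of _ "\<lambda>s. [:\<alpha> s:]"] exI[of _ "\<lambda>s. [:\<beta> s:]"])
         (simp only: const_sum pCons_eq_0_iff, simp)
  qed
qed

text \<open>The multinomial coefficient as a telescoping product of binomial coefficients.\<close>
lemma prod_binomial_partial_sums:
  "(\<Prod>j<k. sum l {..<Suc j} choose sum l {..<j}) * (\<Prod>j<k. fact (l j)) = (fact (sum l {..<k}) :: nat)"
proof (induction k)
  case (Suc k)
  have "fact (sum l {..<k}) * fact (l k) * (sum l {..<Suc k} choose sum l {..<k}) = (fact (sum l {..<Suc k}) :: nat)"
    using binomial_fact_lemma[of "sum l {..<k}" "sum l {..<Suc k}"] by simp
  then show ?case unfolding Suc.IH[symmetric] by (simp add: mult_ac)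
qed simp

section \<open>From subspaces to coordinate vectors\<close>

context vector_space
begin

lemma span_UN_eq_sum:
  assumes "finite J"
  shows "span (\<Union>j\<in>J. B j) = (\<Sum>j\<in>J. span (B j))"
  using assms
proof (induction J rule: finite_induct)
  case empty
  show ?case by (simp add: set_zero)
next
  case (insert j J)
  then show ?case by (simp add: span_Un set_plus_def) blast
qed

text \<open>
  The union of the \<open>B j\<close> has at most as many elements as the sum of the cardinalities, which is the
  dimension of its span. Hence it is a spanning set of minimal size, and so independent; and no
  vector is counted twice, since that would make it smaller than the dimension.
\<close>
lemma independent_disjoint_UN_of_dim_sum:
  assumes fin: "finite J" "\<And>j. j \<in> J \<Longrightarrow> finite (B j)"
    and dim: "dim (\<Sum>j\<in>J. span (B j)) = (\<Sum>j\<in>J. card (B j))"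
  shows "independent (\<Union>j\<in>J. B j)" and "disjoint_family_on B J"
proof -
  let ?W = "\<Union>j\<in>J. B j"
  have finW: "finite ?W" using fin by blast
  have dimW: "dim ?W = (\<Sum>j\<in>J. card (B j))"
    using dim by (simp add: span_UN_eq_sum[OF fin(1), symmetric])
  have card_le: "card ?W \<le> (\<Sum>j\<in>J. card (B j))" using fin(1) by (rule card_UN_le)
  obtain B' where B': "B' \<subseteq> ?W" "independent B'" "?W \<subseteq> span B'" "card B' = dim ?W"
    by (rule basis_exists)
  have "B' = ?W" using card_seteq[OF finW B'(1)] B'(4) dimW card_le by simp
  then show "independent ?W" using B'(2) by simp
  show "disjoint_family_on B J"
    unfolding disjoint_family_on_def
  proof (intro ballI impI, rule ccontr)
    fix j j' assume j: "j \<in> J" "j' \<in> J" "j \<noteq> j'" and "B j \<inter> B j' \<noteq> {}"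
    then obtain x where x: "x \<in> B j" "x \<in> B j'" by blast
    have "?W = (\<Union>i\<in>J - {j}. B i) \<union> (B j - {x})" using j x by auto
    then have "card ?W \<le> card (\<Union>i\<in>J - {j}. B i) + card (B j - {x})" by (simp add: card_Un_le)
    also have "\<dots> < (\<Sum>i\<in>J - {j}. card (B i)) + card (B j)"
      using card_UN_le[of "J - {j}" B] fin card_Diff1_less[OF fin(2)[OF j(1)] x(1)] by simp
    also have "\<dots> = (\<Sum>j\<in>J. card (B j))" using fin(1) j(1) by (simp add: sum.remove)
    also have "\<dots> = card ?W" using \<open>B' = ?W\<close> B'(4) dimW by simp
    finally show False by simp
  qed
qed

end

text \<open>
  This numbers basis vectors column by column. The injection need not fill a block: positions left
  empty are those that the padding vectors take.
\<close>
lemma inj_into_consecutive_blocks: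
  fixes a :: "nat \<Rightarrow> nat" and B :: "nat \<Rightarrow> 'b set"
  assumes "mono a" "disjoint_family_on B {..<k}"
    and "\<And>j. j < k \<Longrightarrow> finite (B j) \<and> card (B j) \<le> a (Suc j) - a j"
  shows "\<exists>e. inj_on e (\<Union>j<k. B j) \<and> (\<forall>j<k. e ` B j \<subseteq> {a j..<a (Suc j)})"
  using assms(2,3)
proof (induction k)
  case (Suc k)
  then obtain e where e: "inj_on e (\<Union>j<k. B j)" "\<forall>j<k. e ` B j \<subseteq> {a j..<a (Suc j)}"
    by (auto simp: disjoint_family_on_def)
  obtain g where g: "inj_on g (B k)" "g ` B k \<subseteq> {a k..<a (Suc k)}"
    using card_le_inj[of "B k" "{a k..<a (Suc k)}"] Suc.prems(2)[of k] by auto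
  have disj: "b \<notin> B k" if "b \<in> B j" "j < k" for b j
    using Suc.prems(1) that unfolding disjoint_family_on_def
    by (metis IntI empty_iff less_not_refl lessThan_iff less_Suc_eq)
  have below: "e b < a k" if "b \<in> B j" "j < k" for b j
  proof -
    have "e b < a (Suc j)" using e(2) that by fastforce
    also have "a (Suc j) \<le> a k" by (rule monoD[OF \<open>mono a\<close>]) (use that in simp)
    finally show ?thesis .
  qed
  let ?h = "\<lambda>b. if b \<in> B k then g b else e b"
  have "inj_on ?h (\<Union>j<Suc k. B j)"
  proof (rule inj_onI)
    fix x y assume xy: "x \<in> (\<Union>j<Suc k. B j)" "y \<in> (\<Union>j<Suc k. B j)" "?h x = ?h y"
    have x: "if x \<in> B k then a k \<le> ?h x else x \<in> (\<Union>j<k. B j) \<and> ?h x < a k"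
      using xy(1) g(2) below by (auto simp: less_Suc_eq)
    have y: "if y \<in> B k then a k \<le> ?h y else y \<in> (\<Union>j<k. B j) \<and> ?h y < a k"
      using xy(2) g(2) below by (auto simp: less_Suc_eq)
    show "x = y"
      using x y xy(3) inj_onD[OF g(1), of x y] inj_onD[OF e(1), of x y]
      by (auto split: if_splits)
  qed
  moreover have "\<forall>j<Suc k. ?h ` B j \<subseteq> {a j..<a (Suc j)}"
    using e(2) g(2) disj by (auto simp: less_Suc_eq)
  ultimately show ?case by blast
qed simp

context vector_space
begin

text \<open>
  Every position \<open>s\<close> of row \<open>i\<close> gets a coordinate vector \<open>X i s\<close>, also the positions without a basis
  vector. The coordinate \<open>(i, r)\<close> of a vector is, if position \<open>r\<close> of row \<open>i\<close> holds a
  basis vector, the coefficient at that vector in a basis of the whole space that extends the basis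
  of row \<open>i\<close>. An empty position \<open>s\<close> receives the unit vector at the coordinate \<open>(i, s)\<close>, and vectors of
  the original space have coordinate 0 there. The functional reading off the coordinate \<open>(i, r)\<close>
  is therefore dual to \<open>X i r\<close> within row \<open>i\<close>. The second conclusion keeps track of membership: a
  nonzero vector of subspace \<open>j\<close> of row \<open>i\<close> has its coordinates \<open>\<phi>\<close> combined from block \<open>j\<close> of \<open>X i\<close>,
  and \<open>\<phi>\<close> does not depend on \<open>i\<close> or \<open>j\<close>.
\<close>
lemma padded_coordinates:
  fixes B :: "nat \<Rightarrow> nat \<Rightarrow> 'b set" and a :: "nat \<Rightarrow> nat" and k m :: nat
  assumes "mono a"
    and indep: "\<forall>i<m. independent (\<Union>j<k. B i j)"
    and disj: "\<forall>i<m. disjoint_family_on (B i) {..<k}"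
    and fin: "\<forall>i<m. \<forall>j<k. finite (B i j) \<and> card (B i j) \<le> a (Suc j) - a j"
  shows "\<exists>(X :: nat \<Rightarrow> nat \<Rightarrow> nat \<times> nat \<Rightarrow> 'a) (\<phi> :: nat \<times> nat \<Rightarrow> 'b \<Rightarrow> 'a).
    (\<forall>i<m. \<forall>s r. X i s (i, r) = (if s = r then 1 else 0)) \<and>
    (\<forall>i<m. \<forall>j<k. \<forall>v\<in>span (B i j). v \<noteq> 0 \<longrightarrow>
      (\<exists>\<alpha>. (\<exists>s\<in>{a j..<a (Suc j)}. \<alpha> s \<noteq> 0) \<and>
        (\<forall>c. fst c < m \<longrightarrow> (\<Sum>s\<in>{a j..<a (Suc j)}. \<alpha> s * X i s c) = \<phi> c v)))"
proof -
  define W where "W = (\<lambda>i. \<Union>j<k. B i j)"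
  have "\<forall>i\<in>{..<m}. \<exists>e. inj_on e (W i) \<and> (\<forall>j<k. e ` B i j \<subseteq> {a j..<a (Suc j)})"
    unfolding W_def
    by (intro ballI inj_into_consecutive_blocks[OF \<open>mono a\<close>]) (simp_all add: disj fin)
  from bchoice[OF this] obtain e where
    "\<forall>i\<in>{..<m}. inj_on (e i) (W i) \<and> (\<forall>j<k. e i ` B i j \<subseteq> {a j..<a (Suc j)})" by (rule exE)
  then have e: "\<And>i. i < m \<Longrightarrow> inj_on (e i) (W i)"
       "\<And>i j. i < m \<Longrightarrow> j < k \<Longrightarrow> e i ` B i j \<subseteq> {a j..<a (Suc j)}"
    by simp_all
  define d where "d = (\<lambda>i. inv_into (W i) (e i))"
  have de: "d i (e i b) = b" if "i < m" "b \<in> W i" for i b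
    using that e(1) by (simp add: d_def)
  define \<phi> where "\<phi> = (\<lambda>(i', r) v. if r \<in> e i' ` W i'
      then representation (extend_basis (W i')) v (d i' r) else 0)"
  define X where "X = (\<lambda>i s c. if s \<in> e i ` W i then \<phi> c (d i s) else if c = (i, s) then 1 else 0)"
  have basis: "independent (extend_basis (W i))" "v \<in> span (extend_basis (W i))" "W i \<subseteq> extend_basis (W i)"
    if "i < m" for i v
    using indep[rule_format, OF that] independent_extend_basis span_extend_basis extend_basis_superset
    by (auto simp: W_def)
  have \<phi>_sum: "\<phi> c (\<Sum>b\<in>T. g b *s b) = (\<Sum>b\<in>T. g b * \<phi> c b)" if "fst c < m" for c g T
    using basis that by (cases c) (simp add: \<phi>_def representation_sum representation_scale)
  show ?thesis
  proof (intro exI[of _ X] exI[of _ \<phi>] conjI allI ballI impI)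
    fix i s r assume i: "i < m"
    show "X i s (i, r) = (if s = r then 1 else 0)"
    proof (cases "s \<in> e i ` W i")
      case True
      then obtain b where b: "b \<in> W i" "s = e i b" by blast
      show ?thesis
      proof (cases "r \<in> e i ` W i")
        case r: True
        then obtain b' where b': "b' \<in> W i" "r = e i b'" by blast
        have "b \<in> extend_basis (W i)" using basis(3)[OF i] b by blast
        then show ?thesis
          using b b' i inj_on_eq_iff[OF e(1)[OF i] b(1) b'(1)]
          by (auto simp: X_def \<phi>_def de representation_basis[OF basis(1)[OF i]])
      next
        case False
        then show ?thesis using True by (auto simp: X_def \<phi>_def)
      qed
    qed (simp add: X_def)
  next
    fix i j v assume i: "i < m" and j: "j < k" and v: "v \<in> span (B i j)" "v \<noteq> 0"
    have BW: "B i j \<subseteq> W i" using j by (auto simp: W_def)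
    obtain g where g: "v = (\<Sum>b\<in>B i j. g b *s b)"
      using v(1) span_finite[of "B i j"] fin[rule_format, OF i j] by auto
    define \<alpha> where "\<alpha> = (\<lambda>s. if s \<in> e i ` B i j then g (d i s) else 0)"
    have \<alpha>e: "\<alpha> (e i b) = g b" if "b \<in> B i j" for b
      using that BW de[OF i] by (auto simp: \<alpha>_def)
    obtain b where b: "b \<in> B i j" "g b *s b \<noteq> 0"
      using v(2) unfolding g by (rule sum.not_neutral_contains_not_neutral)
    have "\<exists>s\<in>{a j..<a (Suc j)}. \<alpha> s \<noteq> 0"
    proof (rule bexI)
      show "\<alpha> (e i b) \<noteq> 0" using b by (auto simp: \<alpha>e)
      show "e i b \<in> {a j..<a (Suc j)}" using e(2)[OF i j] b(1) by blast
    qed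
    moreover have "(\<Sum>s\<in>{a j..<a (Suc j)}. \<alpha> s * X i s c) = \<phi> c v" if c: "fst c < m" for c
    proof -
      have "(\<Sum>s\<in>{a j..<a (Suc j)}. \<alpha> s * X i s c) = (\<Sum>s\<in>e i ` B i j. \<alpha> s * X i s c)"
        by (rule sum.mono_neutral_right) (use e(2)[OF i j] in \<open>auto simp: \<alpha>_def\<close>)
      also have "\<dots> = (\<Sum>b\<in>B i j. \<alpha> (e i b) * X i (e i b) c)"
        by (rule sum.reindex_cong[OF inj_on_subset[OF e(1)[OF i] BW]]) simp_all
      also have "\<dots> = (\<Sum>b\<in>B i j. g b * \<phi> c b)"
      proof (rule sum.cong[OF refl])
        fix b assume b: "b \<in> B i j"
        then have "b \<in> W i" using BW by blast
        then have "X i (e i b) c = \<phi> c b" by (simp add: X_def de[OF i])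
        then show "\<alpha> (e i b) * X i (e i b) c = g b * \<phi> c b" by (simp add: \<alpha>e[OF b])
      qed
      finally show ?thesis by (simp add: g \<phi>_sum[OF c])
    qed
    ultimately show "\<exists>\<alpha>. (\<exists>s\<in>{a j..<a (Suc j)}. \<alpha> s \<noteq> 0) \<and>
        (\<forall>c. fst c < m \<longrightarrow> (\<Sum>s\<in>{a j..<a (Suc j)}. \<alpha> s * X i s c) = \<phi> c v)" by blast
  qed
qed

end

section \<open>The theorem\<close>

text \<open>
  Choose bases of the subspaces, number and pad them, and take the coordinates of a common vector
  of two intersecting subspaces as the linear relation between their blocks.
\<close>
theorem theorem2:
  fixes scale :: "'f::field \<Rightarrow> 'u::ab_group_add \<Rightarrow> 'u"
    and k m :: nat
    and l :: "nat \<Rightarrow> nat"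
    and U :: "nat \<Rightarrow> nat \<Rightarrow> 'u set"
  assumes "vector_space scale"
    and "k \<ge> 1" and "m \<ge> 1"
    and "\<And>j. j \<in> {1..k} \<Longrightarrow> l j \<ge> 1"
    and "\<And>i j. i \<in> {1..m} \<Longrightarrow> j \<in> {1..k} \<Longrightarrow> module.subspace scale (U i j)"
    and "\<And>i j. i \<in> {1..m} \<Longrightarrow> j \<in> {1..k} \<Longrightarrow> vector_space.dim_at_most scale (U i j) (l j)"
    and "\<And>i. i \<in> {1..m} \<Longrightarrow>
           vector_space.dim scale (\<Sum>j=1..k. U i j) = (\<Sum>j=1..k. vector_space.dim scale (U i j))"
    and "\<And>i i'. 1 \<le> i \<Longrightarrow> i < i' \<Longrightarrow> i' \<le> m \<Longrightarrow>
           \<exists>j j'. 1 \<le> j \<and> j < j' \<and> j' \<le> k \<and> U i j \<inter> U i' j' \<noteq> {0}"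
  shows "real m \<le> fact (\<Sum>r=1..k. l r) / (\<Prod>r=1..k. fact (l r))"
proof -
  interpret vector_space scale by fact
  \<comment> \<open>Rows and columns are numbered from 0 from here on.\<close>
  define V where "V = (\<lambda>i j. U (Suc i) (Suc j))"
  define l' where "l' = (\<lambda>j. l (Suc j))"
  define a where "a = (\<lambda>j. sum l' {..<j})"
  have a_Suc: "a (Suc j) - a j = l' j" for j by (simp add: a_def)
  have "mono a" by (rule incseq_SucI) (simp add: a_def)
  have sub: "subspace (V i j)" and dimV: "dim_at_most (V i j) (l' j)" if "i < m" "j < k" for i j
    using assms(5,6) that by (simp_all add: V_def l'_def)
  have "\<forall>i\<in>{..<m}. \<forall>j\<in>{..<k}. \<exists>B. finite B \<and> span B = V i j \<and> card B = dim (V i j)"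
  proof (intro ballI)
    fix i j assume "i \<in> {..<m}" "j \<in> {..<k}"
    then have ij: "i < m" "j < k" by simp_all
    obtain B0 where B0: "finite B0" "span B0 = V i j"
      using dimV[OF ij] by (auto simp: dim_at_most_def)
    obtain B where B: "B \<subseteq> V i j" "independent B" "V i j \<subseteq> span B" "card B = dim (V i j)"
      by (rule basis_exists)
    have "finite B" using independent_span_bound[OF B0(1) B(2)] B(1) B0(2) by simp
    moreover have "span B = V i j"
      using span_minimal[OF B(1) sub[OF ij]] B(3) by (rule subset_antisym)
    ultimately show "\<exists>B. finite B \<and> span B = V i j \<and> card B = dim (V i j)" using B(4) by blast
  qed
  then have "\<exists>B. \<forall>i\<in>{..<m}. \<forall>j\<in>{..<k}. finite (B i j) \<and> span (B i j) = V i j \<and> card (B i j) = dim (V i j)"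
    by (simp only: bchoice_iff)
  then obtain B where B: "finite (B i j)" "span (B i j) = V i j" "card (B i j) = dim (V i j)"
    if "i < m" "j < k" for i j by auto
  have "dim (\<Sum>j<k. span (B i j)) = (\<Sum>j<k. card (B i j))" if i: "i < m" for i
  proof -
    have "dim (\<Sum>j<k. V i j) = (\<Sum>j<k. dim (V i j))"
      using assms(7)[of "Suc i"] i by (simp add: V_def sum.atLeast1_atMost_eq)
    then show ?thesis using B[OF i] by simp
  qed
  then have indep: "\<forall>i<m. independent (\<Union>j<k. B i j)"
    and disj: "\<forall>i<m. disjoint_family_on (B i) {..<k}"
    using independent_disjoint_UN_of_dim_sum[of "{..<k}"] B(1) by simp_all
  have card_B: "\<forall>i<m. \<forall>j<k. finite (B i j) \<and> card (B i j) \<le> a (Suc j) - a j"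
    using B dimV by (simp add: a_Suc dim_at_most_def)
  from padded_coordinates[OF \<open>mono a\<close> indep disj card_B]
  obtain X :: "nat \<Rightarrow> nat \<Rightarrow> nat \<times> nat \<Rightarrow> 'f" and \<phi> where
    X: "\<forall>i<m. \<forall>s r. X i s (i, r) = (if s = r then 1 else 0)" and
    \<phi>: "\<forall>i<m. \<forall>j<k. \<forall>v\<in>span (B i j). v \<noteq> 0 \<longrightarrow>
      (\<exists>\<alpha>. (\<exists>s\<in>{a j..<a (Suc j)}. \<alpha> s \<noteq> 0) \<and>
        (\<forall>c. fst c < m \<longrightarrow> (\<Sum>s\<in>{a j..<a (Suc j)}. \<alpha> s * X i s c) = \<phi> c v))"
    by (elim exE conjE)
  let ?C = "{..<m} \<times> {..<a k}"
  have "m \<le> (\<Prod>j<k. a (Suc j) choose a j)"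
  proof (rule skew_flag_bound_domain[OF \<open>mono a\<close>, of ?C m k X])
    show "finite ?C" by simp
  next
    fix i assume i: "i < m"
    have "(\<Sum>c\<in>?C. (if c = (i, r) then 1 else 0) * X i s c) = (if s = r then 1 else 0)"
      if "r < a k" for s r
      using that i by (simp add: X if_distrib[of "\<lambda>x. x * _"] cong: if_cong)
    then show "\<exists>\<tau>. \<forall>s<a k. \<forall>r<a k. (\<Sum>c\<in>?C. \<tau> r c * X i s c) = (if s = r then 1 else 0)"
      by (intro exI[of _ "\<lambda>r c. if c = (i, r) then 1 else 0"]) simp
  next
    fix i i' assume ii: "i < i'" "i' < m"
    obtain p p' where p: "1 \<le> p" "p < p'" "p' \<le> k" "U (Suc i) p \<inter> U (Suc i') p' \<noteq> {0}"
      using assms(8)[of "Suc i" "Suc i'"] ii by auto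
    define j j' where "j = p - 1" and "j' = p' - 1"
    have j: "j < j'" "j' < k" "j < k" using p by (auto simp: j_def j'_def)
    have meet: "V i j \<inter> V i' j' \<noteq> {0}" using p by (simp add: V_def j_def j'_def)
    have "0 \<in> V i j \<inter> V i' j'" using sub ii j by (simp add: subspace_0)
    with meet obtain v where v: "v \<in> V i j" "v \<in> V i' j'" "v \<noteq> 0" by blast
    have "i < m" using ii by simp
    have "v \<in> span (B i j)" "v \<in> span (B i' j')"
      using v B(2)[OF \<open>i < m\<close> \<open>j < k\<close>] B(2)[OF \<open>i' < m\<close> \<open>j' < k\<close>] by simp_all
    from \<phi>[rule_format, OF \<open>i < m\<close> \<open>j < k\<close> this(1) v(3)]
    obtain \<alpha> where \<alpha>: "\<exists>s\<in>{a j..<a (Suc j)}. \<alpha> s \<noteq> 0"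
      "\<forall>c. fst c < m \<longrightarrow> (\<Sum>s\<in>{a j..<a (Suc j)}. \<alpha> s * X i s c) = \<phi> c v" by (elim exE conjE)
    from \<phi>[rule_format, OF \<open>i' < m\<close> \<open>j' < k\<close> \<open>v \<in> span (B i' j')\<close> v(3)]
    obtain \<beta> where \<beta>:
      "\<forall>c. fst c < m \<longrightarrow> (\<Sum>s\<in>{a j'..<a (Suc j')}. \<beta> s * X i' s c) = \<phi> c v" by (elim exE conjE)
    show "\<exists>j j' \<alpha> \<beta>. j < j' \<and> j' < k \<and> (\<exists>s\<in>{a j..<a (Suc j)}. \<alpha> s \<noteq> 0) \<and>
      (\<forall>c\<in>?C. (\<Sum>s\<in>{a j..<a (Suc j)}. \<alpha> s * X i s c) = (\<Sum>s\<in>{a j'..<a (Suc j')}. \<beta> s * X i' s c))"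
      using j \<alpha> \<beta> by (intro exI[of _ j] exI[of _ j'] exI[of _ \<alpha>] exI[of _ \<beta>]) simp
  qed
  then have "m * (\<Prod>j<k. fact (l' j)) \<le> fact (sum l' {..<k})"
    unfolding prod_binomial_partial_sums[symmetric] a_def by (intro mult_right_mono) simp_all
  then have "real (m * (\<Prod>j<k. fact (l' j))) \<le> real (fact (sum l' {..<k}))"
    by (rule of_nat_mono)
  then have "real m * (\<Prod>r=1..k. fact (l r)) \<le> fact (\<Sum>r=1..k. l r)"
    by (simp add: l'_def sum.atLeast1_atMost_eq prod.atLeast1_atMost_eq)
  then show ?thesis by (simp add: le_divide_eq prod_pos)
qed

end
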